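(* Let $k$ be a commutative ring. The forgetful functor $p:\mathbf{XMod}\to k\textbf{-}\mathbf{Alg}$, given on objects by $p(C,R,\partial)=R$ and on morphisms by $p(f,\phi)=\phi$, from the category of crossed modules of commutative $k$-algebras to the category of commutative $k$-algebras, is a fibration of categories (i.e. $\mathbf{XMod}$ is fibred over $k\textbf{-}\mathbf{Alg}$ via $p$), and $p$ has a left adjoint.
   Context: Throughout, $k$ is a fixed commutative ring. All $k$-algebras are commutative and associative, but are not required to have a unit element, and algebra morphisms are $k$-linear multiplicative maps; $k\textbf{-}\mathbf{Alg}$ is the category of these. An action of a $k$-algebra $R$ on a $k$-algebra $C$ is a $k$-bilinear map $R\times C\to C$, $(r,c)\mapsto r\cdot c$, with $(rr')\cdot c=r\cdot(r'\cdot c)$ and $r\cdot(cc')=(r\cdot c)c'$ (so $C$ is an $R$-algebra; no unit condition on the action is imposed). A crossed module $(C,R,\partial)$ consists of $k$-algebras $C,R$, an action of $R$ on $C$, and a $k$-algebra morphism $\partial:C\to R$ with $\partial(r\cdot c)=r\,\partial(c)$ and $\partial(c)\cdot c'=cc'$ (Peiffer identity) for all $r\in R$, $c,c'\in C$. A morphism of crossed modules $(f,\phi):(C,R,\partial)\to(C',R',\partial')$ is a pair of $k$-algebra morphisms $f:C\to C'$, $\phi:R\to R'$ with $\partial' f=\phi\partial$ and $f(r\cdot c)=\phi(r)\cdot f(c)$ for all $r\in R$, $c\in C$. These form the category $\mathbf{XMod}$. Let $\Phi:\mathbf{X}\to\mathbf{B}$ be a functor. A morphism $\varphi:Y\to X$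 in $\mathbf{X}$ over $u:=\Phi(\varphi):J\to I$ is cartesian if for all $v:K\to J$ in $\mathbf{B}$ and all $\theta:Z\to X$ in $\mathbf{X}$ with $\Phi(\theta)=uv$ there is a unique $\psi:Z\to Y$ with $\Phi(\psi)=v$ and $\theta=\varphi\psi$. The functor $\Phi$ is a fibration if for every $u:J\to I$ in $\mathbf{B}$ and every object $X$ of $\mathbf{X}$ with $\Phi(X)=I$ there is a cartesian morphism $\varphi:Y\to X$ with $\Phi(\varphi)=u$. *)

theory Defs
  imports "HOL-Algebra.Module" "HOL-Library.FuncSet"
begin

section \<open>Categories, functors, fibrations and adjunctions\<close>

text \<open>
  \<open>Comp C g f\<close> is the composite \<open>g \<circ> f\<close> (first \<open>f\<close>, then \<open>g\<close>).
  Values of the operations on arguments that are not objects, arrows or composable pairs of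
  arrows are irrelevant.
\<close>

record ('o, 'a) cat =
  Obj :: "'o set"
  Arr :: "'a set"
  Dom :: "'a \<Rightarrow> 'o"
  Cod :: "'a \<Rightarrow> 'o"
  Id :: "'o \<Rightarrow> 'a"
  Comp :: "'a \<Rightarrow> 'a \<Rightarrow> 'a"

definition Hom :: "('o, 'a) cat \<Rightarrow> 'o \<Rightarrow> 'o \<Rightarrow> 'a set" where
  "Hom C x y = {f \<in> Arr C. Dom C f = x \<and> Cod C f = y}"

locale category =
  fixes C :: "('o, 'a) cat"
  assumes Dom_closed: "f \<in> Arr C \<Longrightarrow> Dom C f \<in> Obj C"
    and Cod_closed: "f \<in> Arr C \<Longrightarrow> Cod C f \<in> Obj C"
    and Id_closed: "x \<in> Obj C \<Longrightarrow> Id C x \<in> Hom C x x"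
    and Comp_closed: "\<lbrakk>f \<in> Hom C x y; g \<in> Hom C y z\<rbrakk> \<Longrightarrow> Comp C g f \<in> Hom C x z"
    and Comp_Id_left: "f \<in> Hom C x y \<Longrightarrow> Comp C (Id C y) f = f"
    and Comp_Id_right: "f \<in> Hom C x y \<Longrightarrow> Comp C f (Id C x) = f"
    and Comp_assoc: "\<lbrakk>f \<in> Hom C w x; g \<in> Hom C x y; h \<in> Hom C y z\<rbrakk>
      \<Longrightarrow> Comp C h (Comp C g f) = Comp C (Comp C h g) f"

record ('o, 'a, 'p, 'b) func =
  Fobj :: "'o \<Rightarrow> 'p"
  Farr :: "'a \<Rightarrow> 'b"

locale cat_functor = X: category X + B: category B
  for X :: "('o, 'a) cat" and B :: "('p, 'b) cat" +
  fixes F :: "('o, 'a, 'p, 'b) func"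
  assumes Fobj_closed: "x \<in> Obj X \<Longrightarrow> Fobj F x \<in> Obj B"
    and Farr_closed: "f \<in> Hom X x y \<Longrightarrow> Farr F f \<in> Hom B (Fobj F x) (Fobj F y)"
    and Farr_Id: "x \<in> Obj X \<Longrightarrow> Farr F (Id X x) = Id B (Fobj F x)"
    and Farr_Comp: "\<lbrakk>f \<in> Hom X x y; g \<in> Hom X y z\<rbrakk>
      \<Longrightarrow> Farr F (Comp X g f) = Comp B (Farr F g) (Farr F f)"

definition cartesian ::
    "('o, 'a) cat \<Rightarrow> ('p, 'b) cat \<Rightarrow> ('o, 'a, 'p, 'b) func \<Rightarrow> 'a \<Rightarrow> bool" where
  "cartesian X B \<Phi> \<phi> \<longleftrightarrow> \<phi> \<in> Arr X \<and>
     (\<forall>v \<in> Arr B. \<forall>\<theta> \<in> Arr X.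
        Cod B v = Dom B (Farr \<Phi> \<phi>) \<and> Cod X \<theta> = Cod X \<phi> \<and>
        Farr \<Phi> \<theta> = Comp B (Farr \<Phi> \<phi>) v \<longrightarrow>
        (\<exists>!\<psi>. \<psi> \<in> Hom X (Dom X \<theta>) (Dom X \<phi>) \<and> Farr \<Phi> \<psi> = v \<and> \<theta> = Comp X \<phi> \<psi>))"

locale fibration = cat_functor X B \<Phi>
  for X :: "('o, 'a) cat" and B :: "('p, 'b) cat" and \<Phi> :: "('o, 'a, 'p, 'b) func" +
  assumes cartesian_lift:
    "\<lbrakk>u \<in> Arr B; x \<in> Obj X; Fobj \<Phi> x = Cod B u\<rbrakk>
      \<Longrightarrow> \<exists>\<phi>. cartesian X B \<Phi> \<phi> \<and> Cod X \<phi> = x \<and> Farr \<Phi> \<phi> = u"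

text \<open>\<open>L\<close> is left adjoint to \<open>\<Phi>\<close>: there are bijections \<open>Hom(L b, x) \<cong> Hom(b, \<Phi> x)\<close>,
  natural in \<open>b\<close> and \<open>x\<close>.\<close>

definition left_adjoint ::
    "('o, 'a) cat \<Rightarrow> ('p, 'b) cat \<Rightarrow> ('p, 'b, 'o, 'a) func \<Rightarrow> ('o, 'a, 'p, 'b) func \<Rightarrow> bool" where
  "left_adjoint X B L \<Phi> \<longleftrightarrow> cat_functor B X L \<and> cat_functor X B \<Phi> \<and>
     (\<exists>\<alpha>. (\<forall>b \<in> Obj B. \<forall>x \<in> Obj X.
             bij_betw (\<alpha> b x) (Hom X (Fobj L b) x) (Hom B b (Fobj \<Phi> x))) \<and>
          (\<forall>b \<in> Obj B. \<forall>b' \<in> Obj B. \<forall>x \<in> Obj X. \<forall>x' \<in> Obj X.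
             \<forall>h \<in> Hom B b' b. \<forall>f \<in> Hom X (Fobj L b) x. \<forall>g \<in> Hom X x x'.
               \<alpha> b' x' (Comp X g (Comp X f (Farr L h)))
                 = Comp B (Farr \<Phi> g) (Comp B (\<alpha> b x f) h)))"

definition has_left_adjoint ::
    "('o, 'a) cat \<Rightarrow> ('p, 'b) cat \<Rightarrow> ('o, 'a, 'p, 'b) func \<Rightarrow> bool" where
  "has_left_adjoint X B \<Phi> \<longleftrightarrow> (\<exists>L. left_adjoint X B L \<Phi>)"


section \<open>Commutative, not necessarily unital algebras\<close>

text \<open>
  The record type \<open>('k, 'u) module\<close> has a field \<open>one\<close>. It is unconstrained below and never used:
  neither algebras nor their morphisms know about a unit. The underlying sets of algebras are
  subsets of a type \<open>'u\<close>, which plays the role of the universe of sets. Any infinite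
  \<open>'u\<close> is closed under binary products up to bijection, hence under the pullbacks \<open>C \<times>\<^sub>R S\<close> along
  which crossed modules are transported.
  As usual for HOL-Algebra records, operations are unconstrained outside the carriers; objects
  that differ only there (or in the field \<open>one\<close>) are isomorphic via the identity map.
\<close>

locale k_algebra = module k A
  for k :: "('k, 'm) ring_scheme" (structure) and A :: "('k, 'u) module" (structure) +
  assumes mult_closed:
      "\<lbrakk>x \<in> carrier A; y \<in> carrier A\<rbrakk> \<Longrightarrow> x \<otimes>\<^bsub>A\<^esub> y \<in> carrier A"
    and mult_assoc:
      "\<lbrakk>x \<in> carrier A; y \<in> carrier A; z \<in> carrier A\<rbrakk>
        \<Longrightarrow> (x \<otimes>\<^bsub>A\<^esub> y) \<otimes>\<^bsub>A\<^esub> z = x \<otimes>\<^bsub>A\<^esub> (y \<otimes>\<^bsub>A\<^esub> z)"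
    and mult_comm:
      "\<lbrakk>x \<in> carrier A; y \<in> carrier A\<rbrakk> \<Longrightarrow> x \<otimes>\<^bsub>A\<^esub> y = y \<otimes>\<^bsub>A\<^esub> x"
    and mult_distrib:
      "\<lbrakk>x \<in> carrier A; y \<in> carrier A; z \<in> carrier A\<rbrakk>
        \<Longrightarrow> (x \<oplus>\<^bsub>A\<^esub> y) \<otimes>\<^bsub>A\<^esub> z = (x \<otimes>\<^bsub>A\<^esub> z) \<oplus>\<^bsub>A\<^esub> (y \<otimes>\<^bsub>A\<^esub> z)"
    and mult_smult:
      "\<lbrakk>a \<in> carrier k; x \<in> carrier A; y \<in> carrier A\<rbrakk>
        \<Longrightarrow> (a \<odot>\<^bsub>A\<^esub> x) \<otimes>\<^bsub>A\<^esub> y = a \<odot>\<^bsub>A\<^esub> (x \<otimes>\<^bsub>A\<^esub> y)"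

text \<open>Morphisms are taken extensional, so that they are equal iff they agree on the carrier.\<close>

definition alg_hom ::
    "('k, 'm) ring_scheme \<Rightarrow> ('k, 'u) module \<Rightarrow> ('k, 'u) module \<Rightarrow> ('u \<Rightarrow> 'u) set" where
  "alg_hom k A B = {f \<in> carrier A \<rightarrow>\<^sub>E carrier B.
     (\<forall>x \<in> carrier A. \<forall>y \<in> carrier A.
        f (x \<oplus>\<^bsub>A\<^esub> y) = f x \<oplus>\<^bsub>B\<^esub> f y \<and> f (x \<otimes>\<^bsub>A\<^esub> y) = f x \<otimes>\<^bsub>B\<^esub> f y) \<and>
     (\<forall>a \<in> carrier k. \<forall>x \<in> carrier A. f (a \<odot>\<^bsub>A\<^esub> x) = a \<odot>\<^bsub>B\<^esub> f x)}"

datatype ('o, 'f) arrow = Arrow (adom: 'o) (amap: 'f) (acod: 'o)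

definition kAlg ::
    "('k, 'm) ring_scheme \<Rightarrow> (('k, 'u) module, (('k, 'u) module, 'u \<Rightarrow> 'u) arrow) cat" where
  "kAlg k = \<lparr>
     Obj = {A. k_algebra k A},
     Arr = {Arrow A f B | A f B. k_algebra k A \<and> k_algebra k B \<and> f \<in> alg_hom k A B},
     Dom = adom,
     Cod = acod,
     Id = (\<lambda>A. Arrow A (\<lambda>x \<in> carrier A. x) A),
     Comp = (\<lambda>g f. Arrow (adom f) (compose (carrier (adom f)) (amap g) (amap f)) (acod g))\<rparr>"


section \<open>Crossed modules of commutative algebras\<close>

locale alg_action = R: k_algebra k R + C: k_algebra k C
  for k :: "('k, 'm) ring_scheme" and R :: "('k, 'u) module" and C :: "('k, 'u) module" +
  fixes act :: "'u \<Rightarrow> 'u \<Rightarrow> 'u"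
  assumes act_closed: "\<lbrakk>r \<in> carrier R; c \<in> carrier C\<rbrakk> \<Longrightarrow> act r c \<in> carrier C"
    and act_add_left:
      "\<lbrakk>r \<in> carrier R; r' \<in> carrier R; c \<in> carrier C\<rbrakk>
        \<Longrightarrow> act (r \<oplus>\<^bsub>R\<^esub> r') c = act r c \<oplus>\<^bsub>C\<^esub> act r' c"
    and act_add_right:
      "\<lbrakk>r \<in> carrier R; c \<in> carrier C; c' \<in> carrier C\<rbrakk>
        \<Longrightarrow> act r (c \<oplus>\<^bsub>C\<^esub> c') = act r c \<oplus>\<^bsub>C\<^esub> act r c'"
    and act_smult_left:
      "\<lbrakk>a \<in> carrier k; r \<in> carrier R; c \<in> carrier C\<rbrakk>
        \<Longrightarrow> act (a \<odot>\<^bsub>R\<^esub> r) c = a \<odot>\<^bsub>C\<^esub> act r c"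
    and act_smult_right:
      "\<lbrakk>a \<in> carrier k; r \<in> carrier R; c \<in> carrier C\<rbrakk>
        \<Longrightarrow> act r (a \<odot>\<^bsub>C\<^esub> c) = a \<odot>\<^bsub>C\<^esub> act r c"
    and act_mult_left:
      "\<lbrakk>r \<in> carrier R; r' \<in> carrier R; c \<in> carrier C\<rbrakk>
        \<Longrightarrow> act (r \<otimes>\<^bsub>R\<^esub> r') c = act r (act r' c)"
    and act_mult_right:
      "\<lbrakk>r \<in> carrier R; c \<in> carrier C; c' \<in> carrier C\<rbrakk>
        \<Longrightarrow> act r (c \<otimes>\<^bsub>C\<^esub> c') = act r c \<otimes>\<^bsub>C\<^esub> c'"

record ('k, 'u) xmod =
  xtop :: "('k, 'u) module"
  xbase :: "('k, 'u) module"
  xbdry :: "'u \<Rightarrow> 'u"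
  xact :: "'u \<Rightarrow> 'u \<Rightarrow> 'u"

locale crossed_module = alg_action k "xbase X" "xtop X" "xact X"
  for k :: "('k, 'm) ring_scheme" and X :: "('k, 'u) xmod" +
  assumes bdry_hom: "xbdry X \<in> alg_hom k (xtop X) (xbase X)"
    and bdry_act:
      "\<lbrakk>r \<in> carrier (xbase X); c \<in> carrier (xtop X)\<rbrakk>
        \<Longrightarrow> xbdry X (xact X r c) = r \<otimes>\<^bsub>xbase X\<^esub> xbdry X c"
    and Peiffer:
      "\<lbrakk>c \<in> carrier (xtop X); c' \<in> carrier (xtop X)\<rbrakk>
        \<Longrightarrow> xact X (xbdry X c) c' = c \<otimes>\<^bsub>xtop X\<^esub> c'"

definition xmod_hom ::
    "('k, 'm) ring_scheme \<Rightarrow> ('k, 'u) xmod \<Rightarrow> ('k, 'u) xmod \<Rightarrow> (('u \<Rightarrow> 'u) \<times> ('u \<Rightarrow> 'u)) set" where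
  "xmod_hom k X Y = {(f, \<phi>).
     f \<in> alg_hom k (xtop X) (xtop Y) \<and> \<phi> \<in> alg_hom k (xbase X) (xbase Y) \<and>
     (\<forall>c \<in> carrier (xtop X). xbdry Y (f c) = \<phi> (xbdry X c)) \<and>
     (\<forall>r \<in> carrier (xbase X). \<forall>c \<in> carrier (xtop X). f (xact X r c) = xact Y (\<phi> r) (f c))}"

definition XMod ::
    "('k, 'm) ring_scheme
      \<Rightarrow> (('k, 'u) xmod, (('k, 'u) xmod, ('u \<Rightarrow> 'u) \<times> ('u \<Rightarrow> 'u)) arrow) cat" where
  "XMod k = \<lparr>
     Obj = {X. crossed_module k X},
     Arr = {Arrow X h Y | X h Y. crossed_module k X \<and> crossed_module k Y \<and> h \<in> xmod_hom k X Y},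
     Dom = adom,
     Cod = acod,
     Id = (\<lambda>X. Arrow X (\<lambda>c \<in> carrier (xtop X). c, \<lambda>r \<in> carrier (xbase X). r) X),
     Comp = (\<lambda>g f. Arrow (adom f)
       (compose (carrier (xtop (adom f))) (fst (amap g)) (fst (amap f)),
        compose (carrier (xbase (adom f))) (snd (amap g)) (snd (amap f)))
       (acod g))\<rparr>"

definition forget_base ::
    "(('k, 'u) xmod, (('k, 'u) xmod, ('u \<Rightarrow> 'u) \<times> ('u \<Rightarrow> 'u)) arrow,
      ('k, 'u) module, (('k, 'u) module, 'u \<Rightarrow> 'u) arrow) func" where
  "forget_base = \<lparr>
     Fobj = xbase,
     Farr = (\<lambda>h. Arrow (xbase (adom h)) (snd (amap h)) (xbase (acod h)))\<rparr>"

end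

theory Submission
  imports Defs
begin

text \<open>
  A cartesian lift of \<open>u : S \<rightarrow> R\<close> at \<open>(C, R, \<partial>)\<close> is the pullback \<open>C \<times>\<^sub>R S\<close> with boundary the
  projection to \<open>S\<close> and action \<open>s' \<cdot> (c, s) = (u s' \<cdot> c, s' s)\<close>. The left adjoint sends \<open>R\<close> to
  \<open>(0, R, 0)\<close>, since a morphism out of \<open>(0, R, 0)\<close> is determined by its base component.
\<close>

section \<open>The categories and the forgetful functor\<close>

lemma Hom_kAlg_iff:
  "h \<in> Hom (kAlg k) A B \<longleftrightarrow>
     (\<exists>f. h = Arrow A f B \<and> k_algebra k A \<and> k_algebra k B \<and> f \<in> alg_hom k A B)"
  by (auto simp: Hom_def kAlg_def)

lemma Hom_XMod_iff:
  "h \<in> Hom (XMod k) X Y \<longleftrightarrow>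
     (\<exists>f \<phi>. h = Arrow X (f, \<phi>) Y \<and> crossed_module k X \<and> crossed_module k Y
        \<and> (f, \<phi>) \<in> xmod_hom k X Y)"
  by (auto simp: Hom_def XMod_def)

lemma kAlg_simps:
  "Obj (kAlg k) = {A. k_algebra k A}"
  "Dom (kAlg k) = adom" "Cod (kAlg k) = acod"
  "Id (kAlg k) A = Arrow A (\<lambda>x \<in> carrier A. x) A"
  "Comp (kAlg k) g f = Arrow (adom f) (compose (carrier (adom f)) (amap g) (amap f)) (acod g)"
  by (simp_all add: kAlg_def)

lemma XMod_simps:
  "Obj (XMod k) = {X. crossed_module k X}"
  "Dom (XMod k) = adom" "Cod (XMod k) = acod"
  "Id (XMod k) X = Arrow X (\<lambda>c \<in> carrier (xtop X). c, \<lambda>r \<in> carrier (xbase X). r) X"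
  "Comp (XMod k) g f = Arrow (adom f)
     (compose (carrier (xtop (adom f))) (fst (amap g)) (fst (amap f)),
      compose (carrier (xbase (adom f))) (snd (amap g)) (snd (amap f))) (acod g)"
  by (simp_all add: XMod_def)

lemma forget_base_simps:
  "Fobj forget_base = xbase"
  "Farr forget_base h = Arrow (xbase (adom h)) (snd (amap h)) (xbase (acod h))"
  by (simp_all add: forget_base_def)

section \<open>Morphisms of algebras\<close>

lemma alg_homD:
  assumes "f \<in> alg_hom k A B"
  shows "x \<in> carrier A \<Longrightarrow> f x \<in> carrier B"
    and "f \<in> extensional (carrier A)"
    and "\<lbrakk>x \<in> carrier A; y \<in> carrier A\<rbrakk> \<Longrightarrow> f (x \<oplus>\<^bsub>A\<^esub> y) = f x \<oplus>\<^bsub>B\<^esub> f y"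
    and "\<lbrakk>x \<in> carrier A; y \<in> carrier A\<rbrakk> \<Longrightarrow> f (x \<otimes>\<^bsub>A\<^esub> y) = f x \<otimes>\<^bsub>B\<^esub> f y"
    and "\<lbrakk>a \<in> carrier k; x \<in> carrier A\<rbrakk> \<Longrightarrow> f (a \<odot>\<^bsub>A\<^esub> x) = a \<odot>\<^bsub>B\<^esub> f x"
  using assms by (auto simp: alg_hom_def PiE_def)

lemma alg_homI:
  assumes "\<And>x. x \<in> carrier A \<Longrightarrow> f x \<in> carrier B"
    and "f \<in> extensional (carrier A)"
    and "\<And>x y. \<lbrakk>x \<in> carrier A; y \<in> carrier A\<rbrakk> \<Longrightarrow> f (x \<oplus>\<^bsub>A\<^esub> y) = f x \<oplus>\<^bsub>B\<^esub> f y"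
    and "\<And>x y. \<lbrakk>x \<in> carrier A; y \<in> carrier A\<rbrakk> \<Longrightarrow> f (x \<otimes>\<^bsub>A\<^esub> y) = f x \<otimes>\<^bsub>B\<^esub> f y"
    and "\<And>a x. \<lbrakk>a \<in> carrier k; x \<in> carrier A\<rbrakk> \<Longrightarrow> f (a \<odot>\<^bsub>A\<^esub> x) = a \<odot>\<^bsub>B\<^esub> f x"
  shows "f \<in> alg_hom k A B"
  using assms by (auto simp: alg_hom_def PiE_def)

lemma alg_hom_id:
  assumes "k_algebra k A"
  shows "(\<lambda>x \<in> carrier A. x) \<in> alg_hom k A A"
proof -
  interpret k_algebra k A by fact
  show ?thesis by (rule alg_homI) (simp_all add: mult_closed)
qed

lemma alg_hom_compose:
  assumes "k_algebra k A" and f: "f \<in> alg_hom k A B" and g: "g \<in> alg_hom k B D"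
  shows "compose (carrier A) g f \<in> alg_hom k A D"
proof -
  interpret k_algebra k A by fact
  show ?thesis
    by (rule alg_homI) (simp_all add: compose_eq mult_closed alg_homD[OF f] alg_homD[OF g])
qed

text \<open>The zero of \<open>A\<close> is the scalar zero times itself, so compatibility with
  scalars alone forces this value.\<close>

lemma alg_hom_zero:
  assumes "k_algebra k A" "k_algebra k B" and f: "f \<in> alg_hom k A B"
  shows "f \<zero>\<^bsub>A\<^esub> = \<zero>\<^bsub>B\<^esub>"
proof -
  interpret A: k_algebra k A by fact
  interpret B: k_algebra k B by fact
  have "f \<zero>\<^bsub>A\<^esub> = f (\<zero>\<^bsub>k\<^esub> \<odot>\<^bsub>A\<^esub> \<zero>\<^bsub>A\<^esub>)" by simp
  also have "\<dots> = \<zero>\<^bsub>k\<^esub> \<odot>\<^bsub>B\<^esub> f \<zero>\<^bsub>A\<^esub>" by (rule alg_homD[OF f]) simp_all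
  also have "\<dots> = \<zero>\<^bsub>B\<^esub>" by (simp add: alg_homD[OF f])
  finally show ?thesis .
qed

lemma alg_hom_minus:
  assumes "k_algebra k A" "k_algebra k B" and f: "f \<in> alg_hom k A B" and x: "x \<in> carrier A"
  shows "f (\<ominus>\<^bsub>A\<^esub> x) = \<ominus>\<^bsub>B\<^esub> f x"
proof -
  interpret A: k_algebra k A by fact
  interpret B: k_algebra k B by fact
  have "f (\<ominus>\<^bsub>A\<^esub> x) \<oplus>\<^bsub>B\<^esub> f x = f (\<ominus>\<^bsub>A\<^esub> x \<oplus>\<^bsub>A\<^esub> x)"
    using x by (simp add: alg_homD[OF f])
  then have "f (\<ominus>\<^bsub>A\<^esub> x) \<oplus>\<^bsub>B\<^esub> f x = \<zero>\<^bsub>B\<^esub>"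
    using x by (simp add: A.M.l_neg alg_hom_zero[OF assms(1,2) f])
  then show ?thesis
    using x by (metis A.M.a_inv_closed B.M.minus_equality alg_homD(1)[OF f])
qed

section \<open>Morphisms of crossed modules\<close>

lemma crossed_module_algebras:
  assumes "crossed_module k X"
  shows "k_algebra k (xtop X)" "k_algebra k (xbase X)"
  using assms by (simp_all add: crossed_module_def alg_action_def)

lemma xmod_homD:
  assumes "(f, \<phi>) \<in> xmod_hom k X Y"
  shows "f \<in> alg_hom k (xtop X) (xtop Y)" "\<phi> \<in> alg_hom k (xbase X) (xbase Y)"
    and "c \<in> carrier (xtop X) \<Longrightarrow> xbdry Y (f c) = \<phi> (xbdry X c)"
    and "\<lbrakk>r \<in> carrier (xbase X); c \<in> carrier (xtop X)\<rbrakk> \<Longrightarrow> f (xact X r c) = xact Y (\<phi> r) (f c)"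
  using assms by (auto simp: xmod_hom_def)

lemma xmod_hom_id:
  assumes "crossed_module k X"
  shows "(\<lambda>c \<in> carrier (xtop X). c, \<lambda>r \<in> carrier (xbase X). r) \<in> xmod_hom k X X"
proof -
  interpret crossed_module k X by fact
  show ?thesis
    using alg_hom_id[OF crossed_module_algebras(1)[OF assms]]
      alg_hom_id[OF crossed_module_algebras(2)[OF assms]]
    by (simp add: xmod_hom_def act_closed alg_homD(1)[OF bdry_hom])
qed

lemma xmod_hom_compose:
  assumes X: "crossed_module k X"
    and f: "(f, \<phi>) \<in> xmod_hom k X Y" and g: "(g, \<gamma>) \<in> xmod_hom k Y Z"
  shows "(compose (carrier (xtop X)) g f, compose (carrier (xbase X)) \<gamma> \<phi>) \<in> xmod_hom k X Z"
proof -
  interpret crossed_module k X by fact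
  note F = xmod_homD[OF f] and G = xmod_homD[OF g]
  show ?thesis
    using alg_hom_compose[OF crossed_module_algebras(1)[OF X] F(1) G(1)]
      alg_hom_compose[OF crossed_module_algebras(2)[OF X] F(2) G(2)]
    by (simp add: xmod_hom_def compose_eq act_closed alg_homD(1)[OF bdry_hom]
        F(3,4) G(3,4) alg_homD(1)[OF F(1)] alg_homD(1)[OF F(2)])
qed

section \<open>The category and functor laws\<close>

lemma compose_id_left:
  "f \<in> alg_hom k A B \<Longrightarrow> compose (carrier A) (\<lambda>x \<in> carrier B. x) f = f"
  by (rule extensionalityI[of _ "carrier A"]) (auto simp: compose_eq alg_homD)

lemma compose_id_right:
  "f \<in> alg_hom k A B \<Longrightarrow> compose (carrier A) f (\<lambda>x \<in> carrier A. x) = f"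
  by (rule extensionalityI[of _ "carrier A"]) (auto simp: compose_eq alg_homD)

text \<open>The two sides differ only in the restriction of the composite of \<open>h\<close> and
  \<open>g\<close> to \<open>carrier B\<close>, which is invisible after \<open>f\<close> because
  \<open>f\<close> lands there.\<close>

lemma compose_assoc_hom:
  "f \<in> alg_hom k A B \<Longrightarrow>
    compose (carrier A) h (compose (carrier A) g f) = compose (carrier A) (compose (carrier B) h g) f"
  by (rule extensionalityI[of _ "carrier A"]) (auto simp: compose_eq alg_homD)

lemma category_kAlg: "category (kAlg k)"
  by unfold_locales
    (auto simp: Hom_kAlg_iff kAlg_simps alg_hom_id alg_hom_compose compose_id_left compose_id_right
      compose_assoc_hom, auto simp: kAlg_def)

lemma category_XMod: "category (XMod k)"
proof
  fix f g x y z
  assume "f \<in> Hom (XMod k) x y" "g \<in> Hom (XMod k) y z"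
  then show "Comp (XMod k) g f \<in> Hom (XMod k) x z"
    by (auto simp: Hom_XMod_iff XMod_simps intro: xmod_hom_compose)
next
  fix f g h w x y z
  assume "f \<in> Hom (XMod k) w x" "g \<in> Hom (XMod k) x y" "h \<in> Hom (XMod k) y z"
  then show "Comp (XMod k) h (Comp (XMod k) g f) = Comp (XMod k) (Comp (XMod k) h g) f"
    by (auto simp: Hom_XMod_iff XMod_simps
        intro: compose_assoc_hom[OF xmod_homD(1)] compose_assoc_hom[OF xmod_homD(2)])
next
  fix f x y
  assume "f \<in> Hom (XMod k) x y"
  then show "Comp (XMod k) (Id (XMod k) y) f = f" "Comp (XMod k) f (Id (XMod k) x) = f"
    by (auto simp: Hom_XMod_iff XMod_simps
        intro: compose_id_left[OF xmod_homD(1)] compose_id_left[OF xmod_homD(2)]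
          compose_id_right[OF xmod_homD(1)] compose_id_right[OF xmod_homD(2)])
qed (auto simp: Hom_XMod_iff XMod_simps xmod_hom_id, auto simp: XMod_def)

lemma cat_functor_forget_base: "cat_functor (XMod k) (kAlg k) forget_base"
proof -
  interpret X: category "XMod k" by (rule category_XMod)
  interpret B: category "kAlg k" by (rule category_kAlg)
  show ?thesis
    by unfold_locales
      (auto simp: Hom_XMod_iff Hom_kAlg_iff XMod_simps kAlg_simps forget_base_simps
        crossed_module_algebras dest: xmod_homD)
qed

section \<open>Pullbacks\<close>

text \<open>Pairs are encoded in the universe \<open>'u\<close> by an injection \<open>e\<close>.\<close>

definition pullback_alg ::
    "('u \<times> 'u \<Rightarrow> 'u) \<Rightarrow> ('u \<Rightarrow> 'u) \<Rightarrow> ('u \<Rightarrow> 'u) \<Rightarrow> ('k, 'u) module \<Rightarrow> ('k, 'u) module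
      \<Rightarrow> ('k, 'u) module" where
  "pullback_alg e d u C S = \<lparr>
     carrier = e ` {(c, s). c \<in> carrier C \<and> s \<in> carrier S \<and> d c = u s},
     mult = (\<lambda>x y. e (fst (inv_into UNIV e x) \<otimes>\<^bsub>C\<^esub> fst (inv_into UNIV e y), snd (inv_into UNIV e x) \<otimes>\<^bsub>S\<^esub> snd (inv_into UNIV e y))),
     one = undefined,
     zero = e (\<zero>\<^bsub>C\<^esub>, \<zero>\<^bsub>S\<^esub>),
     add = (\<lambda>x y. e (fst (inv_into UNIV e x) \<oplus>\<^bsub>C\<^esub> fst (inv_into UNIV e y), snd (inv_into UNIV e x) \<oplus>\<^bsub>S\<^esub> snd (inv_into UNIV e y))),
     smult = (\<lambda>a x. e (a \<odot>\<^bsub>C\<^esub> fst (inv_into UNIV e x), a \<odot>\<^bsub>S\<^esub> snd (inv_into UNIV e x)))\<rparr>"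

text \<open>Eliminates \<open>inv_into\<close>: an arbitrary element is first destructed into a code
  \<open>e (c, s)\<close>, and on such codes all operations are componentwise. Later goals thereby
  split into one about \<open>C\<close> and one about \<open>S\<close>.\<close>

lemma pullback_alg_simps:
  assumes "inj e"
  shows "x \<in> carrier (pullback_alg e d u C S) \<longleftrightarrow>
      (\<exists>c s. x = e (c, s) \<and> c \<in> carrier C \<and> s \<in> carrier S \<and> d c = u s)"
    and "e (c, s) \<otimes>\<^bsub>pullback_alg e d u C S\<^esub> e (c', s') = e (c \<otimes>\<^bsub>C\<^esub> c', s \<otimes>\<^bsub>S\<^esub> s')"
    and "e (c, s) \<oplus>\<^bsub>pullback_alg e d u C S\<^esub> e (c', s') = e (c \<oplus>\<^bsub>C\<^esub> c', s \<oplus>\<^bsub>S\<^esub> s')"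
    and "a \<odot>\<^bsub>pullback_alg e d u C S\<^esub> e (c, s) = e (a \<odot>\<^bsub>C\<^esub> c, a \<odot>\<^bsub>S\<^esub> s)"
    and "\<zero>\<^bsub>pullback_alg e d u C S\<^esub> = e (\<zero>\<^bsub>C\<^esub>, \<zero>\<^bsub>S\<^esub>)"
    and "e (c, s) = e (c', s') \<longleftrightarrow> c = c' \<and> s = s'"
  using assms by (auto simp: pullback_alg_def inj_eq)

text \<open>Every operation preserves the equation \<open>d c = u s\<close> because \<open>d\<close>
  and \<open>u\<close> are both algebra morphisms into \<open>R\<close>; the laws themselves hold in
  each component.\<close>

lemma k_algebra_pullback:
  assumes e: "inj e" and alg: "k_algebra k C" "k_algebra k S" "k_algebra k R"
    and d: "d \<in> alg_hom k C R" and u: "u \<in> alg_hom k S R"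
  shows "k_algebra k (pullback_alg e d u C S)"
proof -
  interpret C: k_algebra k C by fact
  interpret S: k_algebra k S by fact
  note simps = pullback_alg_simps[OF e] alg_homD(3-5)[OF d] alg_homD(3-5)[OF u]
    alg_hom_zero[OF alg(1,3) d] alg_hom_zero[OF alg(2,3) u]
    C.mult_closed S.mult_closed
  let ?P = "pullback_alg e d u C S"
  have ab: "abelian_group ?P"
  proof (rule abelian_groupI)
    fix x assume "x \<in> carrier ?P"
    then obtain c s where x: "x = e (c, s)" "c \<in> carrier C" "s \<in> carrier S" "d c = u s"
      by (auto simp: simps)
    have "e (\<ominus>\<^bsub>C\<^esub> c, \<ominus>\<^bsub>S\<^esub> s) \<in> carrier ?P"
      using x by (auto simp: simps alg_hom_minus[OF alg(1,3) d] alg_hom_minus[OF alg(2,3) u])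
    moreover have "e (\<ominus>\<^bsub>C\<^esub> c, \<ominus>\<^bsub>S\<^esub> s) \<oplus>\<^bsub>?P\<^esub> x = \<zero>\<^bsub>?P\<^esub>"
      using x by (simp add: simps C.M.l_neg S.M.l_neg)
    ultimately show "\<exists>y \<in> carrier ?P. y \<oplus>\<^bsub>?P\<^esub> x = \<zero>\<^bsub>?P\<^esub>" by blast
  qed (auto simp: simps C.M.a_assoc S.M.a_assoc intro: C.M.a_comm S.M.a_comm)
  show ?thesis
    by (intro k_algebra.intro k_algebra_axioms.intro moduleI C.cring_axioms ab)
      (auto simp: simps C.smult_l_distr S.smult_l_distr C.smult_r_distr S.smult_r_distr
        C.smult_assoc1 S.smult_assoc1 C.mult_assoc S.mult_assoc C.mult_distrib S.mult_distrib
        C.mult_smult S.mult_smult intro: C.mult_comm S.mult_comm)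
qed

section \<open>Crossed modules pulled back along a morphism of base algebras\<close>

definition pullback_xmod ::
    "('u \<times> 'u \<Rightarrow> 'u) \<Rightarrow> ('u \<Rightarrow> 'u) \<Rightarrow> ('k, 'u) module \<Rightarrow> ('k, 'u) xmod \<Rightarrow> ('k, 'u) xmod" where
  "pullback_xmod e u S X = \<lparr>
     xtop = pullback_alg e (xbdry X) u (xtop X) S,
     xbase = S,
     xbdry = (\<lambda>x \<in> carrier (pullback_alg e (xbdry X) u (xtop X) S). snd (inv_into UNIV e x)),
     xact = (\<lambda>s x. e (xact X (u s) (fst (inv_into UNIV e x)), s \<otimes>\<^bsub>S\<^esub> snd (inv_into UNIV e x)))\<rparr>"

text \<open>The rule for the boundary is conditional since that map is restricted to the carrier,
  which makes it extensional as membership in \<open>alg_hom\<close> demands.\<close>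

lemma pullback_xmod_simps:
  assumes "inj e"
  shows "xtop (pullback_xmod e u S X) = pullback_alg e (xbdry X) u (xtop X) S"
    and "xbase (pullback_xmod e u S X) = S"
    and "e (c, s) \<in> carrier (pullback_alg e (xbdry X) u (xtop X) S)
      \<Longrightarrow> xbdry (pullback_xmod e u S X) (e (c, s)) = s"
    and "xbdry (pullback_xmod e u S X)
      \<in> extensional (carrier (pullback_alg e (xbdry X) u (xtop X) S))"
    and "xact (pullback_xmod e u S X) s' (e (c, s)) = e (xact X (u s') c, s' \<otimes>\<^bsub>S\<^esub> s)"
  using assms by (auto simp: pullback_xmod_def)

text \<open>The action stays inside the pullback because \<partial>(u s' . c) = u s' \<partial>(c) =
  u (s' s) whenever \<partial>(c) = u s. For the Peiffer identity, the boundary s of (c, s) acts on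
  the first component of (c', s') through u s = \<partial>(c), hence as multiplication by c, and on
  the second as multiplication by s.\<close>

lemma crossed_module_pullback:
  assumes e: "inj e" and X: "crossed_module k X" and S: "k_algebra k S"
    and u: "u \<in> alg_hom k S (xbase X)"
  shows "crossed_module k (pullback_xmod e u S X)"
proof -
  interpret crossed_module k X by fact
  interpret S: k_algebra k S by fact
  let ?P = "pullback_xmod e u S X" and ?T = "pullback_alg e (xbdry X) u (xtop X) S"
  note simps = pullback_alg_simps[OF e] pullback_xmod_simps[OF e] alg_homD(1,3-5)[OF bdry_hom]
    alg_homD(1,3-5)[OF u] S.mult_closed C.mult_closed act_closed
  have T: "k_algebra k ?T"
    by (rule k_algebra_pullback[OF e crossed_module_algebras(1)[OF X] S
          crossed_module_algebras(2)[OF X] bdry_hom u])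
  \<comment> \<open>The second component of the action is multiplication in \<open>S\<close>, so
    bilinearity of the action needs the laws for the right factor, obtained here from
    commutativity.\<close>
  have S_distrib_right: "s \<otimes>\<^bsub>S\<^esub> (t \<oplus>\<^bsub>S\<^esub> t') = (s \<otimes>\<^bsub>S\<^esub> t) \<oplus>\<^bsub>S\<^esub> (s \<otimes>\<^bsub>S\<^esub> t')"
    if "s \<in> carrier S" "t \<in> carrier S" "t' \<in> carrier S" for s t t'
    using that by (metis S.mult_comm S.mult_distrib S.M.a_closed)
  have S_smult_right: "s \<otimes>\<^bsub>S\<^esub> (a \<odot>\<^bsub>S\<^esub> t) = a \<odot>\<^bsub>S\<^esub> (s \<otimes>\<^bsub>S\<^esub> t)"
    if "a \<in> carrier k" "s \<in> carrier S" "t \<in> carrier S" for a s t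
    using that by (metis S.mult_comm S.mult_smult S.smult_closed)
  have act: "alg_action k (xbase ?P) (xtop ?P) (xact ?P)"
    unfolding pullback_xmod_simps(1,2)[OF e]
    by (intro alg_action.intro alg_action_axioms.intro S T)
      (auto simp: simps bdry_act act_add_left act_add_right act_smult_left act_smult_right
        act_mult_left act_mult_right S.mult_distrib S_distrib_right S.mult_smult S_smult_right
        S.mult_assoc)
  have bdry: "xbdry ?P \<in> alg_hom k (xtop ?P) (xbase ?P)"
    by (rule alg_homI) (auto simp: simps)
  \<comment> \<open>\<open>Peiffer\<close> is applied from right to left: a product c c' in the top
    algebra becomes the action of \<partial>(c) on c', and the pullback equation then turns
    \<partial>(c) into u s.\<close>
  show ?thesis
    by (intro crossed_module.intro crossed_module_axioms.intro act bdry)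
      (auto simp: simps bdry_act Peiffer simp flip: Peiffer)
qed

section \<open>Cartesian lifts\<close>

text \<open>This is the universal property of the pullback. Let (f, u v) be a morphism from
  \<open>Z\<close> to \<open>X\<close>. In a factorization through \<open>P\<close> over v, the
  projection \<open>q\<close> dictates the first component f, and compatibility with the boundaries,
  the boundary of \<open>P\<close> being the projection to \<open>S\<close>, dictates the second
  component v \<partial>.\<close>

lemma cartesian_lift_forget_base:
  fixes e :: "'u \<times> 'u \<Rightarrow> 'u"
  assumes e: "inj e" and X: "crossed_module k X" and S: "k_algebra k S"
    and u: "u \<in> alg_hom k S (xbase X)"
  defines "P \<equiv> pullback_xmod e u S X"
  defines "q \<equiv> \<lambda>x \<in> carrier (xtop P). fst (inv_into UNIV e x)"
  shows "cartesian (XMod k) (kAlg k) forget_base (Arrow P (q, u) X)"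
proof -
  have P: "crossed_module k P"
    unfolding P_def by (rule crossed_module_pullback[OF e X S u])
  interpret X: crossed_module k X by fact
  interpret S: k_algebra k S by fact
  \<comment> \<open>In the numbered uses below, 6 is injectivity of \<open>e\<close>, 7 and 8 are
    the top and base of \<open>P\<close>, 9 and 10 concern its boundary, and 11 its action.\<close>
  note simps = pullback_alg_simps[OF e] pullback_xmod_simps[OF e, where u = u and S = S and X = X, folded P_def]
  have q: "q (e (c, s)) = c" if "c \<in> carrier (xtop X)" "s \<in> carrier S" "xbdry X c = u s" for c s
    using that e by (simp add: q_def simps)
  have q_ext: "q \<in> extensional (carrier (xtop P))"
    by (simp add: q_def)
  have mem: "x \<in> carrier (xtop P) \<longleftrightarrow>
      (\<exists>c s. x = e (c, s) \<and> c \<in> carrier (xtop X) \<and> s \<in> carrier S \<and> xbdry X c = u s)" for x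
    by (simp add: simps)
  note closed = alg_homD(1,3-5)[OF X.bdry_hom] alg_homD(1,3-5)[OF u] X.C.mult_closed
    S.mult_closed X.act_closed X.bdry_act
  have q_hom: "q \<in> alg_hom k (xtop P) (xtop X)"
    by (rule alg_homI) (auto simp: simps q closed q_ext[unfolded simps(7)])
  have qu: "(q, u) \<in> xmod_hom k P X"
  proof -
    have "xbdry X (q x) = u (xbdry P x)" if "x \<in> carrier (xtop P)" for x
      using that by (auto simp: simps q)
    moreover have "q (xact P r x) = xact X (u r) (q x)"
      if "r \<in> carrier (xbase P)" "x \<in> carrier (xtop P)" for r x
      using that by (auto simp: simps q closed)
    ultimately show ?thesis
      using q_hom u by (auto simp: xmod_hom_def simps)
  qed
  \<comment> \<open>The cartesian property with arrows unpacked: a morphism over the composite of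
    \<open>u\<close> and \<open>v\<close> is one whose base component is that restricted
    composite.\<close>
  have lift: "\<exists>!\<psi>. \<psi> \<in> Hom (XMod k) Z P \<and> Farr forget_base \<psi> = Arrow (xbase Z) v S
      \<and> Arrow Z (f, compose (carrier (xbase Z)) u v) X = Comp (XMod k) (Arrow P (q, u) X) \<psi>"
    if Z: "crossed_module k Z" and v: "v \<in> alg_hom k (xbase Z) S"
      and fv: "(f, compose (carrier (xbase Z)) u v) \<in> xmod_hom k Z X" for Z f v
  proof -
    interpret Z: crossed_module k Z by fact
    note F = xmod_homD[OF fv]
    note z = alg_homD[OF Z.bdry_hom] and fh = alg_homD[OF F(1)] and vh = alg_homD[OF v]
    define g where "g = (\<lambda>x \<in> carrier (xtop Z). e (f x, v (xbdry Z x)))"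
    \<comment> \<open>The pair lies in the pullback because \<partial>(f x) = u (v (\<partial> x)),
      which is the boundary square of the given morphism.\<close>
    have g_mem: "e (f x, v (xbdry Z x)) \<in> carrier (xtop P)" if "x \<in> carrier (xtop Z)" for x
      using that by (auto simp: mem simps(6) fh vh z F(3) compose_eq)
    have g_hom: "g \<in> alg_hom k (xtop Z) (xtop P)"
      by (rule alg_homI)
        (simp_all add: g_def g_mem Z.C.mult_closed, simp_all add: simps fh vh z)
    \<comment> \<open>Equivariance is checked by component: the first is equivariance of
      \<open>f\<close> along u v, the second follows from \<partial>(r . x) = r \<partial>(x) in
      \<open>Z\<close> and multiplicativity of \<open>v\<close>.\<close>
    have gv: "(g, v) \<in> xmod_hom k Z P"
      using g_hom v g_mem
      by (auto simp: xmod_hom_def g_def Z.act_closed simps(6-11) F(4) compose_eq fh vh z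
          Z.bdry_act)
    have qg: "compose (carrier (xtop Z)) q g = f"
      by (rule extensionalityI[of _ "carrier (xtop Z)"])
        (simp_all add: compose_eq g_def q fh vh z F(3))
    have uniq: "h = g"
      if h: "(h, v) \<in> xmod_hom k Z P" and qh: "f = compose (carrier (xtop Z)) q h" for h
    proof (rule extensionalityI[of _ "carrier (xtop Z)"])
      fix x assume x: "x \<in> carrier (xtop Z)"
      then have "h x \<in> carrier (xtop P)"
        using alg_homD(1)[OF xmod_homD(1)[OF h]] by blast
      then obtain c s where cs: "h x = e (c, s)" "e (c, s) \<in> carrier (xtop P)"
        by (auto simp: mem)
      have "s = v (xbdry Z x)"
        using xmod_homD(3)[OF h x] cs by (simp add: simps)
      moreover have "c = f x"
        using x cs by (auto simp: qh compose_eq mem simps(6) q)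
      ultimately show "h x = g x"
        using x cs by (simp add: g_def)
    qed (use alg_homD(2)[OF xmod_homD(1)[OF h]] in \<open>simp_all add: g_def\<close>)
    show ?thesis
    proof (rule ex1I[of _ "Arrow Z (g, v) P"])
      show "Arrow Z (g, v) P \<in> Hom (XMod k) Z P
        \<and> Farr forget_base (Arrow Z (g, v) P) = Arrow (xbase Z) v S
        \<and> Arrow Z (f, compose (carrier (xbase Z)) u v) X
            = Comp (XMod k) (Arrow P (q, u) X) (Arrow Z (g, v) P)"
        using Z P gv by (simp add: Hom_XMod_iff forget_base_simps XMod_simps qg simps(8))
    next
      \<comment> \<open>The condition on \<open>Farr forget_base\<close> fixes the base component as
        \<open>v\<close>, so only the top component is left for \<open>uniq\<close>.\<close>
      fix \<psi>
      assume "\<psi> \<in> Hom (XMod k) Z P \<and> Farr forget_base \<psi> = Arrow (xbase Z) v S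
        \<and> Arrow Z (f, compose (carrier (xbase Z)) u v) X = Comp (XMod k) (Arrow P (q, u) X) \<psi>"
      then show "\<psi> = Arrow Z (g, v) P"
        using uniq by (auto simp: Hom_XMod_iff forget_base_simps XMod_simps)
    qed
  qed
  show ?thesis
    unfolding cartesian_def
  proof (intro conjI ballI impI)
    show "Arrow P (q, u) X \<in> Arr (XMod k)"
      using P X qu by (simp add: XMod_def)
  next
    fix v \<theta>
    assume v: "v \<in> Arr (kAlg k)" and \<theta>: "\<theta> \<in> Arr (XMod k)"
      and eq: "Cod (kAlg k) v = Dom (kAlg k) (Farr forget_base (Arrow P (q, u) X)) \<and>
        Cod (XMod k) \<theta> = Cod (XMod k) (Arrow P (q, u) X) \<and>
        Farr forget_base \<theta> = Comp (kAlg k) (Farr forget_base (Arrow P (q, u) X)) v"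
    obtain K v' J where v': "v = Arrow K v' J" "v' \<in> alg_hom k K J"
      using v by (auto simp: kAlg_def)
    obtain Z f \<phi> Y where \<theta>': "\<theta> = Arrow Z (f, \<phi>) Y" "crossed_module k Z" "(f, \<phi>) \<in> xmod_hom k Z Y"
      using \<theta> by (auto simp: XMod_def)
    \<comment> \<open>Arrows carry their domain and codomain, so equality of arrows in the base
      identifies the objects as well as the base component of \<theta>.\<close>
    have *: "J = S" "Y = X" "K = xbase Z" "\<phi> = compose (carrier (xbase Z)) u v'"
      using eq by (auto simp: v' \<theta>' kAlg_simps XMod_simps forget_base_simps simps(8))
    show "\<exists>!\<psi>. \<psi> \<in> Hom (XMod k) (Dom (XMod k) \<theta>) (Dom (XMod k) (Arrow P (q, u) X)) \<and>
        Farr forget_base \<psi> = v \<and> \<theta> = Comp (XMod k) (Arrow P (q, u) X) \<psi>"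
      using lift[of Z v' f] v' \<theta>' by (simp add: * XMod_simps(2))
  qed
qed

text \<open>An infinite set is equinumerous with its square. This supplies the coding of pairs that
  keeps pullbacks inside the universe \<open>'u\<close>.\<close>

lemma infinite_inj_prod:
  assumes "infinite (UNIV :: 'u set)"
  shows "\<exists>e :: 'u \<times> 'u \<Rightarrow> 'u. inj e"
proof -
  obtain e :: "'u \<times> 'u \<Rightarrow> 'u" where "bij_betw e (UNIV \<times> UNIV) UNIV"
    using card_of_Times_same_infinite[OF assms] card_of_ordIso by blast
  then show ?thesis
    by (auto simp: bij_betw_def)
qed

lemma fibration_forget_base:
  assumes "infinite (UNIV :: 'u set)"
  shows "fibration (XMod k) (kAlg k)
    (forget_base :: (('k, 'u) xmod, (('k, 'u) xmod, ('u \<Rightarrow> 'u) \<times> ('u \<Rightarrow> 'u)) arrow,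
      ('k, 'u) module, (('k, 'u) module, 'u \<Rightarrow> 'u) arrow) func)"
proof (intro fibration.intro fibration_axioms.intro cat_functor_forget_base)
  fix h :: "(('k, 'u) module, 'u \<Rightarrow> 'u) arrow" and X :: "('k, 'u) xmod"
  assume h: "h \<in> Arr (kAlg k)" and X: "X \<in> Obj (XMod k)"
    and eq: "Fobj forget_base X = Cod (kAlg k) h"
  obtain e :: "'u \<times> 'u \<Rightarrow> 'u" where e: "inj e"
    using infinite_inj_prod[OF assms] by blast
  obtain S u where u: "h = Arrow S u (xbase X)" "k_algebra k S" "u \<in> alg_hom k S (xbase X)"
    using h eq by (auto simp: kAlg_def forget_base_def)
  have "cartesian (XMod k) (kAlg k) forget_base
    (Arrow (pullback_xmod e u S X)
      (\<lambda>x \<in> carrier (xtop (pullback_xmod e u S X)). fst (inv_into UNIV e x), u) X)"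
    using X by (intro cartesian_lift_forget_base[OF e _ u(2,3)]) (simp add: XMod_simps)
  then show "\<exists>\<phi>. cartesian (XMod k) (kAlg k) forget_base \<phi> \<and> Cod (XMod k) \<phi> = X
      \<and> Farr forget_base \<phi> = h"
    using u(1) by - (intro exI conjI, assumption,
      simp_all add: XMod_simps forget_base_simps pullback_xmod_simps(2)[OF e])
qed

section \<open>The left adjoint\<close>

text \<open>The one-element algebra; \<open>undefined\<close> serves as a point that is available in
  every type.\<close>

definition zero_alg :: "('k, 'u) module" where
  "zero_alg = \<lparr>carrier = {undefined}, mult = (\<lambda>_ _. undefined), one = undefined,
     zero = undefined, add = (\<lambda>_ _. undefined), smult = (\<lambda>_ _. undefined)\<rparr>"

lemma zero_alg_simps:
  "carrier zero_alg = {undefined}" "x \<otimes>\<^bsub>zero_alg\<^esub> y = undefined" "\<zero>\<^bsub>zero_alg\<^esub> = undefined"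
  "x \<oplus>\<^bsub>zero_alg\<^esub> y = undefined" "a \<odot>\<^bsub>zero_alg\<^esub> x = undefined"
  by (simp_all add: zero_alg_def)

lemma k_algebra_zero_alg: "cring k \<Longrightarrow> k_algebra k zero_alg"
  by (intro k_algebra.intro k_algebra_axioms.intro moduleI abelian_groupI)
    (simp_all add: zero_alg_simps)

text \<open>The zero algebra is initial: its only element is its zero, whose image is forced, and
  the resulting constant map is a morphism.\<close>

lemma alg_hom_from_zero:
  assumes "cring k" "k_algebra k B"
  shows "f \<in> alg_hom k zero_alg B \<longleftrightarrow> f = (\<lambda>x \<in> {undefined}. \<zero>\<^bsub>B\<^esub>)"
proof
  assume f: "f \<in> alg_hom k zero_alg B"
  show "f = (\<lambda>x \<in> {undefined}. \<zero>\<^bsub>B\<^esub>)"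
    by (rule extensionalityI[OF alg_homD(2)[OF f]])
      (use alg_hom_zero[OF k_algebra_zero_alg[OF assms(1)] assms(2) f] in
        \<open>simp_all add: zero_alg_simps\<close>)
next
  interpret k_algebra k B by fact
  \<comment> \<open>Zero is the scalar zero times itself, and scalars can be pulled out of
    products.\<close>
  have "\<zero>\<^bsub>B\<^esub> \<otimes>\<^bsub>B\<^esub> \<zero>\<^bsub>B\<^esub> = \<zero>\<^bsub>B\<^esub>"
    using mult_smult[of "\<zero>\<^bsub>k\<^esub>" "\<zero>\<^bsub>B\<^esub>" "\<zero>\<^bsub>B\<^esub>"] by (simp add: mult_closed)
  moreover assume "f = (\<lambda>x \<in> {undefined}. \<zero>\<^bsub>B\<^esub>)"
  ultimately show "f \<in> alg_hom k zero_alg B"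
    by (intro alg_homI) (simp_all add: zero_alg_simps)
qed

definition zero_xmod :: "('k, 'u) module \<Rightarrow> ('k, 'u) xmod" where
  "zero_xmod R = \<lparr>xtop = zero_alg, xbase = R,
     xbdry = (\<lambda>x \<in> {undefined}. \<zero>\<^bsub>R\<^esub>), xact = (\<lambda>_ _. undefined)\<rparr>"

lemma zero_xmod_simps:
  "xtop (zero_xmod R) = zero_alg" "xbase (zero_xmod R) = R"
  "xbdry (zero_xmod R) = (\<lambda>x \<in> {undefined}. \<zero>\<^bsub>R\<^esub>)"
  "xact (zero_xmod R) r c = undefined"
  by (simp_all add: zero_xmod_def)

lemma crossed_module_zero_xmod:
  assumes k: "cring k" and R: "k_algebra k R"
  shows "crossed_module k (zero_xmod R)"
proof -
  interpret R: k_algebra k R by fact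
  \<comment> \<open>With zero boundary, the condition \<partial>(r . c) = r \<partial>(c) becomes
    this absorption law in \<open>R\<close>.\<close>
  have "r \<otimes>\<^bsub>R\<^esub> \<zero>\<^bsub>R\<^esub> = \<zero>\<^bsub>R\<^esub>" if "r \<in> carrier R" for r
    using that R.mult_smult[of "\<zero>\<^bsub>k\<^esub>" "\<zero>\<^bsub>R\<^esub>" r] R.mult_comm[of r "\<zero>\<^bsub>R\<^esub>"]
    by (simp add: R.mult_closed)
  moreover have "(\<lambda>x \<in> {undefined}. \<zero>\<^bsub>R\<^esub>) \<in> alg_hom k zero_alg R"
    using alg_hom_from_zero[OF k R] by blast
  ultimately show ?thesis
    using R k_algebra_zero_alg[OF k]
    by (intro crossed_module.intro crossed_module_axioms.intro alg_action.intro
        alg_action_axioms.intro) (simp_all add: zero_xmod_simps zero_alg_simps)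
qed

text \<open>Initiality of the zero algebra fixes the top component. The boundary square then says
  \<partial>(0) = \<phi>(0), and equivariance says 0 = \<phi>(r) . 0; both hold for every algebra
  morphism \<phi>.\<close>

lemma xmod_hom_from_zero:
  assumes k: "cring k" and R: "k_algebra k R" and Y: "crossed_module k Y"
  shows "(f, \<phi>) \<in> xmod_hom k (zero_xmod R) Y \<longleftrightarrow>
    f = (\<lambda>x \<in> {undefined}. \<zero>\<^bsub>xtop Y\<^esub>) \<and> \<phi> \<in> alg_hom k R (xbase Y)"
proof -
  interpret Y: crossed_module k Y by fact
  note alg = crossed_module_algebras[OF Y]
  have act_zero: "xact Y r \<zero>\<^bsub>xtop Y\<^esub> = \<zero>\<^bsub>xtop Y\<^esub>" if "r \<in> carrier (xbase Y)" for r
    using that Y.act_smult_right[of "\<zero>\<^bsub>k\<^esub>" r "\<zero>\<^bsub>xtop Y\<^esub>"] by (simp add: Y.act_closed)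
  show ?thesis
    using alg_hom_zero[OF R alg(2)] alg_hom_zero[OF alg Y.bdry_hom]
    by (auto simp: xmod_hom_def zero_xmod_simps zero_alg_simps alg_hom_from_zero[OF k alg(1)]
        act_zero alg_homD(1))
qed

section \<open>The functor to crossed modules with zero top, and the adjunction\<close>

definition zero_func ::
    "(('k, 'u) module, (('k, 'u) module, 'u \<Rightarrow> 'u) arrow,
      ('k, 'u) xmod, (('k, 'u) xmod, ('u \<Rightarrow> 'u) \<times> ('u \<Rightarrow> 'u)) arrow) func" where
  "zero_func = \<lparr>Fobj = zero_xmod,
     Farr = (\<lambda>h. Arrow (zero_xmod (adom h)) (\<lambda>x \<in> {undefined}. undefined, amap h)
       (zero_xmod (acod h)))\<rparr>"

lemma zero_func_simps:
  "Fobj zero_func = zero_xmod"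
  "Farr zero_func h = Arrow (zero_xmod (adom h)) (\<lambda>x \<in> {undefined}. undefined, amap h)
     (zero_xmod (acod h))"
  by (simp_all add: zero_func_def)

lemma Hom_XMod_from_zero:
  assumes "cring k" "k_algebra k R" "crossed_module k Y"
  shows "h \<in> Hom (XMod k) (zero_xmod R) Y \<longleftrightarrow>
    (\<exists>\<phi> \<in> alg_hom k R (xbase Y).
       h = Arrow (zero_xmod R) (\<lambda>x \<in> {undefined}. \<zero>\<^bsub>xtop Y\<^esub>, \<phi>) Y)"
  using assms by (auto simp: Hom_XMod_iff xmod_hom_from_zero crossed_module_zero_xmod)

lemma cat_functor_zero_func:
  assumes k: "cring k"
  shows "cat_functor (kAlg k) (XMod k) zero_func"
proof (intro cat_functor.intro cat_functor_axioms.intro category_kAlg category_XMod)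
  fix f A B assume "f \<in> Hom (kAlg k) A B"
  then show "Farr zero_func f \<in> Hom (XMod k) (Fobj zero_func A) (Fobj zero_func B)"
    by (auto simp: Hom_kAlg_iff zero_func_simps Hom_XMod_from_zero[OF k]
        crossed_module_zero_xmod[OF k] zero_xmod_simps zero_alg_simps)
next
  fix f g A B D assume "f \<in> Hom (kAlg k) A B" "g \<in> Hom (kAlg k) B D"
  then show "Farr zero_func (Comp (kAlg k) g f)
      = Comp (XMod k) (Farr zero_func g) (Farr zero_func f)"
    by (auto simp: Hom_kAlg_iff zero_func_simps kAlg_simps XMod_simps zero_xmod_simps
        zero_alg_simps compose_def)
qed (auto simp: kAlg_simps XMod_simps zero_func_simps crossed_module_zero_xmod[OF k]
      zero_xmod_simps zero_alg_simps)

text \<open>The base of \<open>zero_xmod R\<close> is literally \<open>R\<close>, so the adjunction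
  bijection can be \<open>Farr forget_base\<close> itself, and its naturality reduces to
  compatibility of \<open>forget_base\<close> with composition.\<close>

lemma left_adjoint_zero_func:
  fixes k :: "('k, 'm) ring_scheme"
  assumes k: "cring k"
  shows "left_adjoint (XMod k) (kAlg k) (zero_func :: (('k, 'u) module, _, _, _) func) forget_base"
  unfolding left_adjoint_def
proof (intro conjI exI[of _ "\<lambda>_ _. Farr forget_base"] ballI
    cat_functor_zero_func[OF k] cat_functor_forget_base)
  fix R :: "('k, 'u) module" and Y :: "('k, 'u) xmod"
  assume "R \<in> Obj (kAlg k)" "Y \<in> Obj (XMod k)"
  then have R: "k_algebra k R" and Y: "crossed_module k Y"
    by (simp_all add: kAlg_simps XMod_simps)
  \<comment> \<open>The inverse attaches the only possible top component, the zero map, to a given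
    base morphism.\<close>
  show "bij_betw (Farr forget_base) (Hom (XMod k) (Fobj zero_func R) Y)
      (Hom (kAlg k) R (Fobj forget_base Y))"
    using R crossed_module_algebras(2)[OF Y]
    by (intro bij_betwI[where g = "\<lambda>h. Arrow (zero_xmod R)
          (\<lambda>x \<in> {undefined}. \<zero>\<^bsub>xtop Y\<^esub>, amap h) Y"])
      (auto simp: zero_func_simps forget_base_simps Hom_XMod_from_zero[OF k R Y] Hom_kAlg_iff
        zero_xmod_simps)
next
  fix R R' :: "('k, 'u) module" and Y Y' :: "('k, 'u) xmod" and h f g
  assume "h \<in> Hom (kAlg k) R' R" "f \<in> Hom (XMod k) (Fobj zero_func R) Y"
    "g \<in> Hom (XMod k) Y Y'"
  then show "Farr forget_base (Comp (XMod k) g (Comp (XMod k) f (Farr zero_func h)))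
      = Comp (kAlg k) (Farr forget_base g) (Comp (kAlg k) (Farr forget_base f) h)"
    by (auto simp: Hom_kAlg_iff Hom_XMod_iff zero_func_simps forget_base_simps kAlg_simps
        XMod_simps zero_xmod_simps)
qed

theorem proposition3p3:
  fixes k :: "('k, 'm) ring_scheme"
  assumes "cring k"
    and "infinite (UNIV :: 'u set)"
  shows "fibration (XMod k) (kAlg k)
           (forget_base :: (('k, 'u) xmod, (('k, 'u) xmod, ('u \<Rightarrow> 'u) \<times> ('u \<Rightarrow> 'u)) arrow,
             ('k, 'u) module, (('k, 'u) module, 'u \<Rightarrow> 'u) arrow) func)
       \<and> has_left_adjoint (XMod k) (kAlg k)
           (forget_base :: (('k, 'u) xmod, (('k, 'u) xmod, ('u \<Rightarrow> 'u) \<times> ('u \<Rightarrow> 'u)) arrow,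
             ('k, 'u) module, (('k, 'u) module, 'u \<Rightarrow> 'u) arrow) func)"
  using fibration_forget_base[OF assms(2)] left_adjoint_zero_func[OF assms(1)]
  unfolding has_left_adjoint_def by blast

end
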